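(* There are infinitely many $2$-near perfect numbers of the form $n=2^kp^m$ with $k,m$ positive integers, $m\ge 3$, and $p$ an odd prime, if and only if there are infinitely many Mersenne primes.
   Context: $\sigma(n)$ denotes the sum of all positive divisors of $n$. A positive integer $n$ is called $2$-near perfect if there exist two distinct positive divisors $d_1,d_2$ of $n$ with $\sigma(n)=2n+d_1+d_2$. A Mersenne prime is a prime of the form $2^r-1$ with $r$ a positive integer. *)

theory Defs
  imports "HOL-Computational_Algebra.Primes"
begin

definition sigma :: "nat \<Rightarrow> nat" where
  "sigma n = (\<Sum>d | d dvd n. d)"

definition two_near_perfect :: "nat \<Rightarrow> bool" where
  "two_near_perfect n \<longleftrightarrow> n > 0 \<and>
     (\<exists>d1 d2. d1 dvd n \<and> d2 dvd n \<and> d1 \<noteq> d2 \<and> sigma n = 2 * n + d1 + d2)"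

definition mersenne_prime :: "nat \<Rightarrow> bool" where
  "mersenne_prime q \<longleftrightarrow> prime q \<and> (\<exists>r>0. q = 2 ^ r - 1)"

end

(* Write q = 2^(k+1) and S = 1 + p + ... + p^(m-1). Then sigma(2^k p^m) = 2 * 2^k p^m + d1 + d2
   is equivalent to (q - p) S = 1 + d1 + d2. Let d1 = X p^u and d2 = Y p^v with u \<le> v, where the
   powers of two X, Y divide q/2. By size v \<ge> m - 1, and multiplying by p - 1 and reducing modulo p^v
   gives q - 1 + (p - 1) X p^u = h p^v for some h > 0. Each quantity obtained by writing q and the
   larger of X, Y as an even multiple of the other powers of two (for instance g = q/Y - (p - 1)) is
   even and positive, hence at least 2; this gain over the trivial bound 1 makes the estimates
   contradictory in every case except d1 = p, d2 = p^2, q = p + 1, m = 3. So the numbers in question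
   are exactly 2^k p^3 with p = 2^(k+1) - 1 prime. *)

theory Submission
  imports Defs
begin

section \<open>Size and parity estimates for the possible exponent patterns\<close>

lemma even_pos_ge_2: "even (g::int) \<Longrightarrow> g * Y > 0 \<Longrightarrow> Y > 0 \<Longrightarrow> g \<ge> 2"
  by (auto elim!: evenE simp: zero_less_mult_iff)

text \<open>In the following lemmas \<open>q = 2 ^ (k + 1)\<close>, the two divisors are \<open>X * p ^ u\<close> and \<open>Y * p ^ v\<close> with
  \<open>U = p ^ u\<close>, and \<open>M\<close>, \<open>N\<close> stand for \<open>p ^ m\<close>, \<open>p ^ (m - 1)\<close>. "Top" and "next" refer to the
  exponents \<open>m\<close> and \<open>m - 1\<close>, "low" to smaller ones; the first word describes \<open>v\<close>, the second \<open>u\<close>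
  ("small" means \<open>X \<le> Y\<close>, and there \<open>u = m - 1\<close> is allowed as well). When \<open>p ^ u\<close> divides \<open>q - 1\<close> with
  quotient \<open>c\<close>, the equation is stated in terms of \<open>c\<close> instead of \<open>h\<close>.\<close>

lemma no_solution_top_low_small:
  fixes p q h M U X Y R :: int
  assumes p: "p \<ge> 3" "odd p" and X: "0 < X" "X \<le> Y" and h: "h > 0"
    and M: "p ^ 3 \<le> M" and U: "p * U \<le> M" "U > 0" "U < p\<^sup>2 \<Longrightarrow> U \<le> p" "U dvd q - 1"
    and E1: "q - 1 + (p - 1) * X * U = h * M"
    and E2: "q = p + h + (p - 1) * Y"
    and R: "q = R * Y" "even R"
  shows False
proof -
  have "p ^ 3 > 0" using p by simp
  then have M0: "M > 0" using M by linarith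
  \<comment> \<open>Evenness of \<open>g\<close> sharpens \<open>Y <= p + h\<close> to
    \<open>2 * Y <= p + h\<close>. Once \<open>h < Y\<close> is known, this forces
    \<open>Y < p\<close> and then \<open>q < p^2\<close>.\<close>
  define g where "g = R - p + 1"
  have gY: "g * Y = p + h" using E2 R by (simp add: g_def algebra_simps)
  have "even g" using R p by (simp add: g_def)
  then have g: "g \<ge> 2" using even_pos_ge_2[of g Y] gY h p X by simp
  then have "2 * Y \<le> p + h" using mult_right_mono[of 2 g Y] gY X by simp
  \<comment> \<open>If \<open>Y <= h\<close>, then also \<open>X <= h\<close>, and the term with
    \<open>U\<close> covers at most the fraction \<open>(p - 1) / p\<close> of \<open>h * M\<close>.
    The rest gives \<open>h * p^2 <= q - 1\<close>, against \<open>q <= p + p * h\<close>.\<close>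
  have hY: "h < Y"
  proof (rule ccontr)
    assume "\<not> h < Y"
    then have Yh: "Y \<le> h" by simp
    have "p * (h * M) = p * (q - 1) + (p - 1) * X * (p * U)"
      unfolding E1[symmetric] by (simp add: algebra_simps)
    also have "\<dots> \<le> p * (q - 1) + (p - 1) * h * M"
      using X Yh U p M0 by (intro add_left_mono mult_mono) auto
    finally have "h * M \<le> p * (q - 1)" by (simp add: algebra_simps)
    moreover have "h * p ^ 3 \<le> h * M" using M h by simp
    ultimately have "p * (h * p\<^sup>2) \<le> p * (q - 1)" by (simp add: power3_eq_cube power2_eq_square mult_ac)
    then have "h * p\<^sup>2 \<le> q - 1" using p by simp
    moreover have "q \<le> p + p * h" using mult_left_mono[OF Yh, of "p - 1"] p E2 by (simp add: algebra_simps)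
    ultimately have "(h * p) * (p - 1) \<le> 1 * (p - 1)" by (simp add: algebra_simps power2_eq_square)
    then have "h * p \<le> 1" using p by (simp only: mult_le_cancel_right)
    then show False using h p mult_mono[of 1 h 3 p] by simp
  qed
  with \<open>2 * Y \<le> p + h\<close> have Yp: "Y < p" by simp
  have "q < p + p * Y" using E2 hY by (simp add: algebra_simps)
  also have "\<dots> \<le> p\<^sup>2" using mult_left_mono[of Y "p - 1" p] Yp p by (simp add: algebra_simps power2_eq_square)
  finally have q: "q < p\<^sup>2" .
  have "(p - 1) * Y \<ge> 0" using p X by simp
  then have "q > 1" using E2 p h by linarith
  \<comment> \<open>Since \<open>U\<close> divides \<open>q - 1 < p^2\<close>, only
    \<open>U <= p\<close> remains, and the left side of \<open>E1\<close> drops below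
    \<open>p^3\<close>.\<close>
  then have "U \<le> q - 1" using U(4) by (intro zdvd_imp_le) auto
  then have "U \<le> p" using U(3) q by simp
  then have "X * U \<le> (p - 1) * p" using X Yp U p by (intro mult_mono) auto
  then have "(p - 1) * (X * U) \<le> (p - 1) * ((p - 1) * p)" using p by (intro mult_left_mono) auto
  then have "h * M < p\<^sup>2 + (p - 1) * ((p - 1) * p)" using E1 q by (simp add: mult_ac)
  also have "\<dots> = p ^ 3 - p * (p - 1)" by (simp add: algebra_simps power3_eq_cube power2_eq_square)
  also have "\<dots> \<le> p ^ 3" using p by simp
  also have "p ^ 3 \<le> M" by fact
  also have "M \<le> h * M" using h M0 by simp
  finally show False by simp
qed

text \<open>Here \<open>X\<close> is bounded only by \<open>q / 2\<close>, and size alone does not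
  suffice. It reduces everything to \<open>q < p^2\<close>, \<open>M = p^3\<close>,
  \<open>U = p\<close>; there the equations determine \<open>c\<close>, \<open>h\<close> and
  \<open>X\<close> in terms of \<open>Y\<close> and \<open>p\<close>, and divisibility gives the
  contradiction.\<close>

lemma no_solution_top_low_large:
  fixes p q h M U X Y R :: int
  assumes p: "p \<ge> 3" "odd p" and X: "0 < X" "2 * X \<le> q" "X dvd q" and Y: "0 < Y" and h: "h > 0"
    and M: "M = p ^ 3 \<or> p ^ 4 \<le> M" and U: "p\<^sup>2 * U \<le> M" "U > 0" "U < p\<^sup>2 \<Longrightarrow> U = 1 \<or> U = p" "U dvd q - 1"
    and E1: "q - 1 + (p - 1) * X * U = h * M"
    and E2: "q = p + h + (p - 1) * Y"
    and R: "q = R * Y" "even R"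
  shows False
proof -
  have "p ^ 3 \<le> p ^ 4" using p by (intro power_increasing) auto
  then have M3: "p ^ 3 \<le> M" using M by auto
  have p3: "p ^ 3 > 0" and p2: "p\<^sup>2 > 0" using p by auto
  have M0: "M > 0" using M3 p3 by linarith
  have "(p - 1) * Y \<ge> 0" using p Y by simp
  then have q1: "q > 1" using E2 p h by linarith
  define g where "g = R - p + 1"
  have gY: "g * Y = p + h" using E2 R by (simp add: g_def algebra_simps)
  have "even g" using R p by (simp add: g_def)
  then have g: "g \<ge> 2" using even_pos_ge_2[of g Y] gY h p Y by simp
  \<comment> \<open>Eliminating \<open>Y\<close> gives \<open>q = (p + h) * (g + p - 1) / g\<close>,
    which decreases in \<open>g\<close>; \<open>gq\<close> is its value at
    \<open>g = 2\<close>.\<close>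
  have "(p + h) * (p + 1) - 2 * q = Y * ((p - 1) * (g - 2))"
    unfolding gY[symmetric] R by (simp add: g_def algebra_simps)
  moreover have "Y * ((p - 1) * (g - 2)) \<ge> 0" using g Y p by simp
  ultimately have gq: "2 * q \<le> (p + h) * (p + 1)" by linarith
  have "2 * p ^ 3 * h * M = 2 * p ^ 3 * (q - 1) + p * (p - 1) * (2 * X) * (p\<^sup>2 * U)"
    using E1 by (simp add: mult.assoc flip: E1) (simp add: algebra_simps power2_eq_square power3_eq_cube)
  also have "\<dots> \<le> 2 * M * (q - 1) + p * (p - 1) * q * M"
    using X M3 p U M0 q1 by (intro add_mono mult_mono mult_nonneg_nonneg) auto
  finally have "(2 * p ^ 3 * h) * M \<le> (2 * (q - 1) + p * (p - 1) * q) * M" by (simp add: algebra_simps)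
  then have hb: "2 * p ^ 3 * h \<le> 2 * (q - 1) + p * (p - 1) * q" using M0 by simp
  \<comment> \<open>For \<open>q >= p^2\<close> the lower bound on \<open>h\<close> from
    \<open>gq\<close> exceeds the upper bound \<open>hb\<close>.\<close>
  have q: "q < p\<^sup>2"
  proof (rule ccontr)
    assume "\<not> q < p\<^sup>2"
    then have qp: "p\<^sup>2 \<le> q" by simp
    have "4 * p ^ 3 * q \<le> 2 * p ^ 3 * ((p + h) * (p + 1))"
      using mult_left_mono[OF gq, of "2 * p ^ 3"] p3 by simp
    also have "\<dots> = 2 * p\<^sup>2 * (p + 1) * p\<^sup>2 + (p + 1) * (2 * p ^ 3 * h)"
      by (simp add: algebra_simps power2_eq_square power3_eq_cube)
    also have "\<dots> \<le> 2 * p\<^sup>2 * (p + 1) * q + (p + 1) * (2 * q + p * (p - 1) * q)"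
      using qp hb p by (intro add_mono mult_left_mono) auto
    finally have "q * (4 * p ^ 3) \<le> q * (3 * p ^ 3 + 2 * p\<^sup>2 + p + 2)"
      by (simp add: algebra_simps power2_eq_square power3_eq_cube)
    then have "p ^ 3 \<le> 2 * p\<^sup>2 + p + 2" using q1 by simp
    moreover have "3 * p\<^sup>2 \<le> p ^ 3" "3 * p \<le> p\<^sup>2" using p by (simp_all add: power3_eq_cube power2_eq_square)
    ultimately show False using p by simp
  qed
  have "U \<le> q - 1" using U(4) q1 by (intro zdvd_imp_le) auto
  then have U1p: "U = 1 \<or> U = p" using U(3) q by simp
  have XX: "2 * X < p\<^sup>2" using X q by simp
  have bound: "2 * (h * M) < 2 * p\<^sup>2 + (p - 1) * p\<^sup>2 * U"
  proof -
    have "(p - 1) * (2 * X) * U \<le> (p - 1) * p\<^sup>2 * U"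
      using XX p U by (intro mult_right_mono mult_left_mono) auto
    then show ?thesis using E1 q by (simp add: algebra_simps)
  qed
  have hM: "M \<le> h * M" using h M0 by simp
  have pp: "3 * p\<^sup>2 \<le> p ^ 3" "p ^ 4 = p * p ^ 3" "p * p\<^sup>2 = p ^ 3" using p by (simp_all add: power3_eq_cube power2_eq_square eval_nat_numeral)
  \<comment> \<open>For any other pair, \<open>bound\<close> makes \<open>h * M\<close> smaller than
    \<open>M\<close>.\<close>
  have "M = p ^ 3 \<and> U = p"
  proof (rule ccontr)
    assume "\<not> (M = p ^ 3 \<and> U = p)"
    then consider "U = 1" | "U = p" "p ^ 4 \<le> M" using U1p M by auto
    then show False
    proof cases
      case 1
      then have "2 * (h * M) < p\<^sup>2 + p ^ 3" using bound pp by (simp add: algebra_simps)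
      then show False using hM M3 pp p2 by linarith
    next
      case 2
      have "(p - 1) * p\<^sup>2 * U = p ^ 4 - p ^ 3" using 2 by (simp add: algebra_simps eval_nat_numeral)
      then have "p ^ 4 \<le> 2 * p\<^sup>2 - p ^ 3" using bound hM 2 by simp
      moreover have "0 < p * p ^ 3" using p by simp
      ultimately show False using pp p2 by linarith
    qed
  qed
  then have MU: "M = p ^ 3" "U = p" by auto
  then obtain c where c: "q - 1 = p * c" using U(4) by auto
  have "p * (c + (p - 1) * X) = p * (h * p\<^sup>2)" using E1 MU c by (simp add: algebra_simps eval_nat_numeral)
  then have cX: "c + (p - 1) * X = h * p\<^sup>2" using p by simp
  have "2 * h * p\<^sup>2 < p * p\<^sup>2"
  proof -
    have "2 * (h * p ^ 3) < 2 * p\<^sup>2 + (p - 1) * p\<^sup>2 * p" using bound MU by simp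
    also have "\<dots> = p * (2 * p + (p - 1) * p\<^sup>2)" by (simp add: algebra_simps power2_eq_square)
    finally have "p * (2 * h * p\<^sup>2) < p * (2 * p + (p - 1) * p\<^sup>2)"
      by (simp add: power2_eq_square power3_eq_cube mult_ac)
    then have "2 * h * p\<^sup>2 < 2 * p + (p - 1) * p\<^sup>2" using p by simp
    moreover have "2 * p \<le> p\<^sup>2" using p by (simp add: power2_eq_square)
    ultimately show ?thesis by (simp add: algebra_simps)
  qed
  then have hp: "2 * h < p" using p2 by (simp only: mult_less_cancel_right)
  \<comment> \<open>The right side is a multiple of \<open>p\<close>, but \<open>h\<close> and
    \<open>Y\<close> both lie strictly between 0 and \<open>p\<close>, so it must vanish.\<close>
  have Yeq: "p * (c - 1 - Y) = h - 1 - Y" using E2 c by (simp add: algebra_simps)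
  have "(p - 1) * Y < (p - 1) * p" using E2 q h by (simp add: algebra_simps power2_eq_square)
  then have Yp: "Y < p" using p by simp
  have "c - 1 - Y = 0"
  proof (rule ccontr)
    assume "c - 1 - Y \<noteq> 0"
    then have "p * 1 \<le> p * \<bar>c - 1 - Y\<bar>" using p by (intro mult_left_mono) auto
    also have "\<dots> = \<bar>h - 1 - Y\<bar>" unfolding Yeq[symmetric] using p by (simp add: abs_mult)
    finally show False using Yp hp h Y by simp
  qed
  then have ch: "c = Y + 1" "h = Y + 1" using Yeq by auto
  \<comment> \<open>With \<open>c = h\<close>, the difference \<open>h * p^2 - h\<close> contains
    the factor \<open>p - 1\<close>. Hence \<open>h\<close> divides \<open>X\<close> and so
    \<open>q\<close>, but also \<open>q - 1 = p * h\<close>, although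
    \<open>h = Y + 1 >= 2\<close>.\<close>
  have "(p - 1) * X = (p - 1) * (h * (p + 1))" using cX ch by (simp add: algebra_simps power2_eq_square)
  then have "X = h * (p + 1)" using p by simp
  then have "h dvd q" using X(3) by (auto intro: dvd_trans)
  moreover have "h dvd q - 1" using c ch by simp
  ultimately have "h dvd q - (q - 1)" by (rule dvd_diff)
  then show False using ch Y by simp
qed

text \<open>The parity gain is used twice, for \<open>q / Y\<close> and for \<open>Y / X\<close>.
  Together they give \<open>4 * q <= (p + 1)^3 * c\<close>, which is at most
  \<open>4 * p^3 * c\<close> for \<open>p >= 3\<close>, while \<open>q - 1 = c * M\<close> is at
  least \<open>c * p^3\<close>.\<close>

lemma no_solution_top_top:
  fixes p q c M X Y R W :: int
  assumes p: "p \<ge> 3" "odd p" and X: "0 < X" and c: "c > 0"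
    and M: "p ^ 3 \<le> M" and E1: "q - 1 = c * M"
    and E2: "q - p = c + (p - 1) * (X + Y)"
    and R: "q = R * Y" "even R" and W: "Y = W * X" "even W"
    and Y: "Y > 0"
  shows False
proof -
  define g where "g = R - p + 1"
  have gY: "g * Y = p + c + (p - 1) * X" using E2 R by (simp add: g_def algebra_simps)
  have "even g" using R p by (simp add: g_def)
  moreover have "(p - 1) * X > 0" using p X by simp
  ultimately have g: "g \<ge> 2" using even_pos_ge_2[of g Y] gY c p Y by simp
  define f where "f = g * W - (p - 1)"
  have fX: "f * X = p + c" using gY W by (simp add: f_def algebra_simps)
  have "even f" using W p by (simp add: f_def)
  then have "f \<ge> 2" using even_pos_ge_2[of f X] fX c p X by simp
  then have X2: "2 * X \<le> p + c" using mult_right_mono[of 2 f X] fX X by simp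
  have "(p + 1) * (g * Y) - 2 * q = Y * ((p - 1) * (g - 2))"
    unfolding R by (simp add: g_def algebra_simps)
  moreover have "Y * ((p - 1) * (g - 2)) \<ge> 0" using g Y p by simp
  ultimately have "2 * q \<le> (p + 1) * (g * Y)" by linarith
  then have "4 * q \<le> (p + 1) * (2 * (p + c) + (p - 1) * (2 * X))"
    unfolding gY by (simp add: algebra_simps)
  also have "\<dots> \<le> (p + 1) * (2 * (p + c) + (p - 1) * (p + c))"
    using X2 p by (intro mult_left_mono add_left_mono) auto
  also have "\<dots> = (p + 1)\<^sup>2 * (p + c)" by (simp add: algebra_simps power2_eq_square)
  also have "\<dots> \<le> (p + 1)\<^sup>2 * ((p + 1) * c)"
  proof (rule mult_left_mono)
    have "p * 1 \<le> p * c" using p c by (intro mult_left_mono) auto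
    then show "p + c \<le> (p + 1) * c" by (simp add: algebra_simps)
  qed simp
  also have "\<dots> = (p + 1) ^ 3 * c" by (simp add: power2_eq_square power3_eq_cube)
  also have "\<dots> \<le> (4 * p ^ 3) * c"
  proof (rule mult_right_mono)
    have "3 * p\<^sup>2 \<le> p ^ 3" "3 * p \<le> p\<^sup>2" using p by (simp_all add: power3_eq_cube power2_eq_square)
    moreover have "(p + 1) ^ 3 = p ^ 3 + 3 * p\<^sup>2 + 3 * p + 1"
      by (simp add: power3_eq_cube power2_eq_square algebra_simps)
    ultimately show "(p + 1) ^ 3 \<le> 4 * p ^ 3" using p by linarith
  qed (use c in simp)
  also have "\<dots> \<le> 4 * (c * M)" using M c by (simp add: mult_ac)
  finally show False using E1 by simp
qed

text \<open>Estimates reduce to \<open>U = p^2\<close> and \<open>c < p\<close>, where they are no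
  longer strong enough; a divisibility of \<open>c^2 - 1\<close> by \<open>2 * Y\<close> then bounds
  \<open>Y\<close> much better.\<close>

lemma no_solution_top_next:
  fixes p q c U X Y R W :: int
  assumes p: "p \<ge> 3" "odd p" and c: "c > 0" and X: "X > 0" and Y: "0 < Y"
    and U: "U = p\<^sup>2 \<or> p ^ 3 \<le> U" and E1: "q - 1 = c * U"
    and E2: "p * (q - p) = c + (p - 1) * (X + p * Y)"
    and R: "q = R * X" "even R" and W: "X = W * Y" "even W"
  shows False
proof -
  have pp: "3 * p\<^sup>2 \<le> p ^ 3" "3 * p \<le> p\<^sup>2" using p by (simp_all add: power3_eq_cube power2_eq_square)
  then have U2: "p\<^sup>2 \<le> U" using U p by auto
  have "U \<ge> 0" using U2 zero_le_power2[of p] by linarith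
  then have "c * U \<ge> 0" using c by simp
  then have "q > 0" using E1 by linarith
  then have R2: "R \<ge> 2" using R even_pos_ge_2[of R X] X by simp
  define G where "G = p * R - p + 1"
  have "p * 2 \<le> p * R" using R2 p by (intro mult_left_mono) auto
  \<comment> \<open>This is \<open>2 * X <= q\<close> in terms of \<open>G\<close>; the parity gain
    enters only through \<open>F\<close> below.\<close>
  then have G: "G \<ge> p + 1" by (simp add: G_def)
  have GX: "G * X = p\<^sup>2 + c + (p - 1) * p * Y" using E2 R by (simp add: G_def algebra_simps power2_eq_square)
  define F where "F = G * W - p * (p - 1)"
  have FY: "F * Y = p\<^sup>2 + c" using GX W by (simp add: F_def algebra_simps)
  have "even F" using W p by (simp add: F_def)
  then have "F \<ge> 2" using even_pos_ge_2[of F Y] FY c p Y by (simp add: add_pos_pos)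
  then have Y2: "2 * Y \<le> p\<^sup>2 + c" using mult_right_mono[of 2 F Y] FY Y by simp
  have "2 * p * (G * X) - (p + 1) * (p * q) = X * ((p - 1) * (G - (p + 1)))"
    unfolding R by (simp add: G_def algebra_simps)
  moreover have "X * ((p - 1) * (G - (p + 1))) \<ge> 0" using G X p by simp
  ultimately have "(p + 1) * (p * q) \<le> 2 * p * (G * X)" by linarith
  then have "p * ((p + 1) * q) \<le> p * (2 * (G * X))" by (simp add: mult_ac)
  then have "(p + 1) * q \<le> 2 * (G * X)" using p by (simp only: mult_le_cancel_left)
  then have I: "(p + 1) * q \<le> 2 * (p\<^sup>2 + c) + p * (p - 1) * (2 * Y)" unfolding GX by (simp add: algebra_simps)
  also have "\<dots> \<le> 2 * (p\<^sup>2 + c) + p * (p - 1) * (p\<^sup>2 + c)" using Y2 p by (intro add_left_mono mult_left_mono) auto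
  finally have II: "(p + 1) * (c * U + 1) \<le> (p\<^sup>2 - p + 2) * (p\<^sup>2 + c)" using E1 by (simp add: algebra_simps power2_eq_square)
  have key: "\<not> (p + 1) * (p ^ 3 * b + 1) \<le> (p\<^sup>2 - p + 2) * (p\<^sup>2 + c)" if "c \<le> p * b" "1 \<le> b" for b
  proof
    assume a: "(p + 1) * (p ^ 3 * b + 1) \<le> (p\<^sup>2 - p + 2) * (p\<^sup>2 + c)"
    have "p\<^sup>2 - p + 2 \<ge> 0" using pp p by simp
    then have "(p\<^sup>2 - p + 2) * (p\<^sup>2 + c) \<le> (p\<^sup>2 - p + 2) * (p\<^sup>2 * b + p * b)"
      using that p by (intro mult_left_mono add_mono) auto
    also have "\<dots> = (p + 1) * (p ^ 3 * b) - (p + 1) * (p * b) * (p - 2)" by (simp add: algebra_simps eval_nat_numeral)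
    also have "\<dots> \<le> (p + 1) * (p ^ 3 * b)" using p that by simp
    finally show False using a p by (simp add: algebra_simps)
  qed
  \<comment> \<open>For \<open>c >= p\<close> the summand \<open>p^2\<close> in \<open>II\<close> is
    at most \<open>p * c\<close>, so \<open>c\<close> factors out and
    \<open>p^2 - p + 2 < p^2\<close> decides.\<close>
  have cp: "c < p"
  proof (rule ccontr)
    assume "\<not> c < p"
    then have cp: "p \<le> c" by simp
    have "(p + 1) * (p\<^sup>2 * c + 1) \<le> (p + 1) * (c * U + 1)"
      using U2 c p by (intro mult_left_mono) (auto simp: mult.commute)
    with II have "(p + 1) * (p\<^sup>2 * c + 1) \<le> (p\<^sup>2 - p + 2) * (p\<^sup>2 + c)" by linarith
    moreover have "(p\<^sup>2 - p + 2) * (p\<^sup>2 + c) \<le> (p\<^sup>2 - p + 2) * (p * c + c)"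
      using cp p pp by (intro mult_left_mono add_mono) (auto simp: power2_eq_square)
    moreover have "(p\<^sup>2 - p + 2) * (p * c + c) = (p + 1) * (p\<^sup>2 * c) - (p + 1) * c * (p - 2)"
      by (simp add: algebra_simps eval_nat_numeral)
    moreover have "(p + 1) * c * (p - 2) \<ge> 0" using p c by simp
    ultimately have "(p + 1) * (p\<^sup>2 * c + 1) \<le> (p + 1) * (p\<^sup>2 * c)" by linarith
    then show False using p by (simp add: algebra_simps)
  qed
  have "\<not> p ^ 3 \<le> U"
  proof
    assume "p ^ 3 \<le> U"
    moreover have "1 * U \<le> c * U" using c \<open>U \<ge> 0\<close> by (intro mult_right_mono) auto
    ultimately have "(p + 1) * (p ^ 3 * 1 + 1) \<le> (p + 1) * (c * U + 1)"
      using p by (intro mult_left_mono) auto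
    with II have "(p + 1) * (p ^ 3 * 1 + 1) \<le> (p\<^sup>2 - p + 2) * (p\<^sup>2 + c)" by linarith
    then show False using key[of 1] cp by simp
  qed
  then have Up: "q = c * p\<^sup>2 + 1" using U E1 by simp
  have q4: "4 dvd q" and qY: "2 * Y dvd q" using R W by (auto elim!: evenE)
  have "2 * Y dvd p\<^sup>2 + c" using FY \<open>even F\<close> by (metis dvd_refl mult_dvd_mono)
  \<comment> \<open>This combination cancels the terms \<open>c * p^2\<close> and leaves an
    expression free of \<open>p\<close>.\<close>
  then have "2 * Y dvd c * (p\<^sup>2 + c) - q" using qY by simp
  also have "c * (p\<^sup>2 + c) - q = c\<^sup>2 - 1" by (simp add: Up algebra_simps power2_eq_square)
  finally have d: "2 * Y dvd c\<^sup>2 - 1" .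
  show False
  proof (cases "c = 1")
    case True
    \<comment> \<open>An odd square plus 1 is 2 modulo 4.\<close>
    obtain r where "p = 2 * r + 1" using p by (elim oddE)
    then have "q = 4 * (r\<^sup>2 + r) + 2" using Up True by (simp add: power2_eq_square algebra_simps)
    then show False using q4 by presburger
  next
    case False
    then have c2: "c \<ge> 2" using c by simp
    then have "c\<^sup>2 - 1 > 0" using one_less_power[of c 2] by simp
    then have "2 * Y \<le> c\<^sup>2 - 1" using d zdvd_imp_le by blast
    also have "c\<^sup>2 - 1 \<le> c * (p - 1)"
      using mult_left_mono[of c "p - 1" c] cp c unfolding power2_eq_square by linarith
    finally have "p * (p - 1) * (2 * Y) \<le> p * (p - 1) * (c * (p - 1))"
      using p by (intro mult_left_mono) auto
    with I have "(p + 1) * q \<le> 2 * (p\<^sup>2 + c) + p * (p - 1) * (c * (p - 1))" by linarith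
    then have "(p + 1) * (c * p\<^sup>2 + 1) \<le> 2 * (p\<^sup>2 + c) + p * (p - 1) * (c * (p - 1))"
      using Up by simp
    then have "3 * (p\<^sup>2 * c) + p + 1 \<le> 2 * p\<^sup>2 + 2 * c + p * c" by (simp add: algebra_simps eval_nat_numeral)
    moreover have "2 * p\<^sup>2 \<le> p\<^sup>2 * c" "3 * (p * c) \<le> p\<^sup>2 * c" "3 * c \<le> p * c"
      using c2 p by (auto simp: power2_eq_square)
    ultimately show False using c p by linarith
  qed
qed

text \<open>The only pattern with a solution. The bound \<open>N < p ^ 3\<close> is there to yield
  \<open>m = 3\<close>, as \<open>N\<close> stands for \<open>p ^ (m - 1)\<close>.\<close>

lemma solution_next_low:
  fixes p q h N U X Y :: int
  assumes p: "p \<ge> 3" and X: "0 < X" "2 * X \<le> q" and Y: "0 < Y" "2 * Y \<le> q" and h: "h > 0" and q: "p < q"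
    and N: "p\<^sup>2 \<le> N" and U: "p * U \<le> N" "U > 0" "U < p\<^sup>2 \<Longrightarrow> U = 1 \<or> U = p" "U dvd q - 1"
    and E1: "q - 1 + (p - 1) * X * U = h * N"
    and E2: "p * (q - p) = h + (p - 1) * Y"
  shows "q = p + 1 \<and> N < p ^ 3"
proof -
  have pp: "3 * p\<^sup>2 \<le> p ^ 3" "3 * p \<le> p\<^sup>2" using p by (simp_all add: power3_eq_cube power2_eq_square)
  have p2: "p\<^sup>2 > 0" using p by simp
  have N0: "N > 0" using N p2 by linarith
  have "(p - 1) * (2 * Y) \<le> (p - 1) * q" using Y p by (intro mult_left_mono) auto
  then have h1: "(p + 1) * q - 2 * p\<^sup>2 \<le> 2 * h" using E2 by (simp add: algebra_simps power2_eq_square)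
  have "(2 * p\<^sup>2 * h) * N = 2 * p\<^sup>2 * (q - 1) + p * (p - 1) * (2 * X) * (p * U)"
    using E1 by (simp add: mult.assoc flip: E1) (simp add: algebra_simps power2_eq_square power3_eq_cube)
  also have "\<dots> \<le> 2 * N * (q - 1) + p * (p - 1) * q * N"
    using X N p U N0 q by (intro add_mono mult_mono mult_nonneg_nonneg) auto
  also have "\<dots> = (2 * (q - 1) + p * (p - 1) * q) * N" by (simp add: algebra_simps)
  finally have "2 * p\<^sup>2 * h \<le> 2 * (q - 1) + p * (p - 1) * q" using N0 by simp
  moreover have "p\<^sup>2 * ((p + 1) * q - 2 * p\<^sup>2) \<le> p\<^sup>2 * (2 * h)" using h1 by (intro mult_left_mono) auto
  \<comment> \<open>The lower bound on \<open>h\<close> from \<open>2 * Y <= q\<close> and the upper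
    one from \<open>2 * X <= q\<close> are compatible only for \<open>q < 2 * p\<close>.\<close>
  ultimately have "p ^ 3 * q + (p - 2) * q < p ^ 3 * (2 * p)" by (simp add: algebra_simps eval_nat_numeral)
  moreover have "(p - 2) * q \<ge> 0" using p q by simp
  ultimately have "p ^ 3 * q < p ^ 3 * (2 * p)" by simp
  then have q2: "q < 2 * p" using p by (simp only: mult_less_cancel_left) auto
  then have Xp: "X < p" and Yp: "Y < p" using X Y by auto
  have "U \<le> q - 1" using U(4) q p by (intro zdvd_imp_le) auto
  then have "U < p\<^sup>2" using q2 pp(2) p by linarith
  then have "U = 1 \<or> U = p" by (rule U(3))
  then show ?thesis
  proof
    assume U1: "U = 1"
    have "(p - 1) * (2 * X) \<le> (p - 1) * q" using X p by (intro mult_left_mono) auto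
    then have "2 * (h * N) < (p + 1) * q" using E1 U1 by (simp add: algebra_simps)
    also have "\<dots> < (p + 1) * (2 * p)" using q2 p by simp
    also have "\<dots> \<le> 4 * p\<^sup>2" using p by (simp add: algebra_simps power2_eq_square)
    also have "\<dots> \<le> 4 * N" using N by simp
    finally have "h * N < 2 * N" by linarith
    then have h1: "h = 1" using N0 h by simp
    have e: "p * (q - p - Y) = 1 - Y" using E2 h1 by (simp add: algebra_simps)
    have "q - p - Y = 0"
    proof (rule ccontr)
      assume "q - p - Y \<noteq> 0"
      then have "p * 1 \<le> p * \<bar>q - p - Y\<bar>" using p by (intro mult_left_mono) auto
      also have "\<dots> = \<bar>1 - Y\<bar>" unfolding e[symmetric] using p by (simp add: abs_mult)
      finally show False using Yp Y by simp
    qed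
    then have q1: "q = p + 1" using e by simp
    have "(p - 1) * (2 * X) \<le> (p - 1) * (p + 1)" using X p q1 by (intro mult_left_mono) auto
    \<comment> \<open>This contradicts \<open>N >= p^2\<close>, so \<open>U = 1\<close> does not
      occur; the genuine solution has \<open>U = p\<close>.\<close>
    then have "2 * N \<le> 2 * p + (p\<^sup>2 - 1)" using E1 U1 h1 q1 by (simp add: algebra_simps power2_eq_square)
    then show ?thesis using q1 N pp p by simp
  next
    assume Up: "U = p"
    then obtain c where c: "q - 1 = p * c" using U by auto
    have "p * c < p * 2" "p * 0 < p * c" using q2 c q p by linarith+
    then have "c = 1" using p by (simp only: mult_less_cancel_left) auto
    then have q1: "q = p + 1" using c by simp
    have "Y = 1"
    proof (rule ccontr)
      assume "Y \<noteq> 1"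
      then have "(p - 1) * 2 \<le> (p - 1) * Y" using p Y by (intro mult_left_mono) auto
      then show False using E2 q1 h p by simp
    qed
    then have h1: "h = 1" using E2 q1 by simp
    have "p * ((p - 1) * (2 * X)) \<le> p * ((p - 1) * (p + 1))" using X p q1 by (intro mult_left_mono) auto
    then have "2 * N \<le> 2 * p + (p ^ 3 - p)" using E1 Up h1 q1 by (simp add: algebra_simps power2_eq_square power3_eq_cube)
    then show ?thesis using q1 pp p by simp
  qed
qed

text \<open>The bound on \<open>X + Y\<close> reflects that one power of two is at most half the
  other. It gives \<open>(p + 2) * q < 4 * p^2\<close>, whereas \<open>E1\<close> forces
  \<open>q > p^2\<close>.\<close>

lemma no_solution_next_next:
  fixes p q c N X Y :: int
  assumes p: "p \<ge> 3" and XY: "4 * (X + Y) \<le> 3 * q" and c: "c > 0"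
    and N: "p\<^sup>2 \<le> N" and E1: "q - 1 = c * N"
    and E2: "p * (q - p) = c + (p - 1) * (X + Y)"
  shows False
proof -
  have p2: "p\<^sup>2 * c \<le> q - 1" using N c E1 by (simp add: mult.commute)
  moreover have "p\<^sup>2 * 1 \<le> p\<^sup>2 * c" using c by (intro mult_left_mono) auto
  ultimately have q: "p\<^sup>2 < q" by simp
  have "3 * 3 * c \<le> p\<^sup>2 * c" unfolding power2_eq_square using p c by (intro mult_mono) auto
  then have "9 * c < q" using p2 by simp
  moreover have "(p - 1) * (4 * (X + Y)) \<le> (p - 1) * (3 * q)" using XY p by (intro mult_left_mono) auto
  moreover have "4 * p * q - 4 * p\<^sup>2 = 4 * c + (p - 1) * (4 * (X + Y))"
    using E2 by (simp add: algebra_simps power2_eq_square)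
  moreover have "q > 0" using q zero_le_power2[of p] by linarith
  ultimately have "(p + 2) * q < 4 * p\<^sup>2" by (simp only: algebra_simps)
  moreover have "5 * q \<le> (p + 2) * q" using p \<open>q > 0\<close> by (intro mult_right_mono) auto
  ultimately show False using q \<open>q > 0\<close> by linarith
qed

section \<open>Reduction of the divisor equation to the exponent patterns\<close>

lemma near_perfect_equation_solution:
  fixes p q S :: int and a b k m u v :: nat
  assumes p: "p \<ge> 3" "odd p" and q: "q = 2 ^ Suc k" and m: "m \<ge> 3"
    and ab: "a \<le> k" "b \<le> k" and uv: "u \<le> v" "v \<le> m" "u = v \<Longrightarrow> a < b"
    and S: "S = (\<Sum>i<m. p ^ i)"
    and eq: "(q - p) * S = 1 + 2 ^ a * p ^ u + 2 ^ b * p ^ v"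
  shows "q = p + 1 \<and> m = 3"
proof -
  define X Y U :: int where "X = 2 ^ a" and "Y = 2 ^ b" and "U = p ^ u"
  have pow_mono: "p ^ i \<le> p ^ j" if "i \<le> j" for i j using that p by (intro power_increasing) auto
  have q_div: "q = 2 ^ (k - a + 1) * X" "q = 2 ^ (k - b + 1) * Y"
    using ab by (simp_all add: q X_def Y_def flip: power_add)
  have R: "even ((2::int) ^ (k - a + 1))" "even ((2::int) ^ (k - b + 1))" by simp_all
  have "2 ^ Suc a \<le> (2::int) ^ Suc k" "2 ^ Suc b \<le> (2::int) ^ Suc k"
    using ab by (intro power_increasing; simp)+
  then have X: "X > 0" "2 * X \<le> q" "X dvd q" and Y: "Y > 0" "2 * Y \<le> q"
    using dvdI[of q X, OF q_div(1)[unfolded mult.commute[of _ X]]] by (auto simp: X_def Y_def q)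
  have U: "U > 0" "U < p\<^sup>2 \<Longrightarrow> U = 1 \<or> U = p"
  proof -
    show "U > 0" using p by (simp add: U_def)
    assume "U < p\<^sup>2"
    then have "u < 2" unfolding U_def using pow_mono[of 2 u] by (meson not_le)
    then show "U = 1 \<or> U = p" by (auto simp: U_def less_2_cases_iff)
  qed
  have S_eq: "(p - 1) * S = p ^ m - 1" by (simp add: S power_diff_1_eq)
  have "S > 0" unfolding S using p m by (intro sum_pos) (auto simp: lessThan_empty_iff)
  have "X * U > 0" "Y * p ^ v > 0" using X Y U p by simp_all
  then have "(q - p) * S > 0" unfolding eq X_def Y_def U_def by linarith
  then have pq: "p < q" using \<open>S > 0\<close> by (simp add: zero_less_mult_iff)
  \<comment> \<open>The quotient of \<open>q - 1 + (p - 1) * X * U\<close> by \<open>p ^ v\<close>;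
    its definition becomes the equation \<open>E2\<close> of the case lemmas.\<close>
  define h where "h = (q - p) * p ^ (m - v) - (p - 1) * Y"
  have "(q - p) * (p ^ m - 1) = (p - 1) * (1 + X * U + Y * p ^ v)"
    using eq unfolding S_eq[symmetric] X_def Y_def U_def by (simp add: mult_ac)
  moreover have "p ^ m = p ^ (m - v) * p ^ v" using uv by (simp flip: power_add)
  ultimately have H: "q - 1 + (p - 1) * X * U = h * p ^ v"
    by (simp add: h_def algebra_simps)
  have "(p - 1) * X * U \<ge> 0" using p X U by simp
  then have "h * p ^ v > 0" using H pq p by linarith
  then have h: "h > 0" using p by (simp add: zero_less_mult_iff)
  have "U dvd p ^ v" using uv by (auto simp: U_def le_imp_power_dvd)
  then have "U dvd h * p ^ v - (p - 1) * X * U" by simp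
  then have Uq: "U dvd q - 1" by (simp flip: H)
  have M: "p ^ 3 \<le> p ^ m" using m by (rule pow_mono)
  have N: "p\<^sup>2 \<le> p ^ (m - 1)" using m by (intro pow_mono) simp
  have "v \<le> m - 2 \<or> v = m - 1 \<or> v = m" "u \<le> m - 2 \<or> u = m - 1 \<or> u = m" "a \<le> b \<or> b < a"
    "u = m - 1 \<Longrightarrow> u \<le> m - 1" "u \<le> m - 2 \<Longrightarrow> u \<le> m - 1" "v = m - 1 \<Longrightarrow> u \<noteq> m"
    using uv m by auto
  then consider "v \<le> m - 2" | "v = m - 1" "u \<le> m - 2" | "v = m - 1" "u = m - 1"
    | "v = m" "u = m" | "v = m" "u \<le> m - 1" "a \<le> b"
    | "v = m" "u = m - 1" "b < a" | "v = m" "u \<le> m - 2" "b < a"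
    by blast
  then show ?thesis
  proof cases
    case 1
    \<comment> \<open>Each divisor is at most half of \<open>q * p ^ (m - 2)\<close>. This
      disjunction makes one of the two bounds strict.\<close>
    have "X * U < Y * p ^ v \<or> U < p ^ v"
    proof (cases "u = v")
      case True
      then show ?thesis using uv p by (simp add: X_def Y_def U_def)
    next
      case False
      then show ?thesis using uv p by (simp add: U_def)
    qed
    moreover have v: "p ^ v \<le> p ^ (m - 2)" using 1 by (intro pow_mono)
    have "Y * p ^ v + Y * p ^ v \<le> q * p ^ (m - 2)"
      using mult_mono[of "2 * Y" q "p ^ v" "p ^ (m - 2)"] v Y p by simp
    moreover have "X * U + X * U \<le> q * U" using mult_right_mono[of "2 * X" q U] X U by simp
    moreover have "U \<le> p ^ v" unfolding U_def using uv by (intro pow_mono)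
    then have "q * U \<le> q * p ^ (m - 2)"
      using pq p by (intro mult_left_mono order.trans[OF _ v]) auto
    moreover have "q * U < q * p ^ (m - 2)" if "U < p ^ v"
      using that pq p by (intro mult_strict_left_mono less_le_trans[OF _ v]) auto
    ultimately have "X * U + Y * p ^ v < q * p ^ (m - 2)" by (elim disjE) linarith+
    \<comment> \<open>Only the two top terms of \<open>S\<close> and its constant term 1 are needed,
      together with \<open>q >= p + 1\<close>.\<close>
    moreover have "(q - p) * S \<ge> q * p ^ (m - 2) + 1"
    proof -
      define l where "l = m - 3"
      have ml: "m = Suc (Suc (Suc l))" using m by (simp add: l_def)
      have "S = (\<Sum>i<Suc l. p ^ i) + (p + 1) * p ^ (m - 2)" by (simp add: S ml algebra_simps)
      moreover have "(\<Sum>i<Suc l. p ^ i) \<ge> 1"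
        using p by (subst sum.lessThan_Suc_shift) (auto intro!: sum_nonneg)
      ultimately have "1 + (p + 1) * p ^ (m - 2) \<le> S" by simp
      then have "(q - p) * (1 + (p + 1) * p ^ (m - 2)) \<le> (q - p) * S" using pq by (intro mult_left_mono) auto
      then have "(q - p) + (q - p) * (p + 1) * p ^ (m - 2) \<le> (q - p) * S"
        by (simp only: distrib_left[of _ 1] mult.assoc mult_1_right)
      moreover have "q * p ^ (m - 2) \<le> (q - p) * (p + 1) * p ^ (m - 2)"
      proof (rule mult_right_mono)
        have "p * (p + 1) \<le> p * q" using pq p by (intro mult_left_mono) auto
        then show "q \<le> (q - p) * (p + 1)" by (simp add: algebra_simps)
      qed (use p in simp)
      ultimately show ?thesis using pq by linarith
    qed
    ultimately show ?thesis using eq by (simp add: X_def Y_def U_def)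
  next
    case 2
    have "p * U = p ^ Suc u" by (simp add: U_def)
    also have "\<dots> \<le> p ^ (m - 1)" using 2 m by (intro pow_mono) simp
    finally have pU: "p * U \<le> p ^ (m - 1)" .
    have E: "p * (q - p) = h + (p - 1) * Y" using 2 m by (simp add: h_def algebra_simps)
    have "q = p + 1 \<and> p ^ (m - 1) < p ^ 3"
      by (rule solution_next_low[OF p(1) X(1,2) Y h pq N pU U Uq H[unfolded 2(1)] E])
    then show ?thesis using pow_mono[of 3 "m - 1"] m by linarith
  next
    case 3
    then have "a < b" using uv by simp
    then have "2 * X \<le> Y" using power_increasing[of "Suc a" b "2::int"] by (simp add: X_def Y_def)
    then have XY: "4 * (X + Y) \<le> 3 * q" using Y by simp
    \<comment> \<open>Equal exponents let the \<open>X\<close> term be absorbed into the quotient,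
      which becomes the \<open>c\<close> of the case lemma.\<close>
    have E1: "q - 1 = (h - (p - 1) * X) * p ^ (m - 1)" using H 3 by (simp add: U_def algebra_simps)
    then have "(h - (p - 1) * X) * p ^ (m - 1) > 0" using pq p by linarith
    then have c: "h - (p - 1) * X > 0" using p by (simp add: zero_less_mult_iff)
    have E2: "p * (q - p) = (h - (p - 1) * X) + (p - 1) * (X + Y)"
      using 3 m by (simp add: h_def algebra_simps)
    show ?thesis by (rule FalseE, rule no_solution_next_next[OF p(1) XY c N E1 E2])
  next
    case 4
    then have "a < b" using uv by simp
    then have W: "Y = 2 ^ (b - a) * X" "even ((2::int) ^ (b - a))" by (simp_all add: X_def Y_def flip: power_add)
    have E1: "q - 1 = (h - (p - 1) * X) * p ^ m" using H 4 by (simp add: U_def algebra_simps)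
    then have "(h - (p - 1) * X) * p ^ m > 0" using pq p by linarith
    then have c: "h - (p - 1) * X > 0" using p by (simp add: zero_less_mult_iff)
    have E2: "q - p = (h - (p - 1) * X) + (p - 1) * (X + Y)" using 4 by (simp add: h_def algebra_simps)
    show ?thesis by (rule FalseE, rule no_solution_top_top[OF p X(1) c M E1 E2 q_div(2) R(2) W Y(1)])
  next
    case 5
    have "p * U = p ^ Suc u" by (simp add: U_def)
    also have "\<dots> \<le> p ^ m" using 5 m by (intro pow_mono) simp
    finally have pU: "p * U \<le> p ^ m" .
    have XY: "X \<le> Y" using 5 by (simp add: X_def Y_def)
    have Up: "U \<le> p" if "U < p\<^sup>2" using U(2)[OF that] p by auto
    have E: "q - 1 + (p - 1) * X * U = h * p ^ m" "q = p + h + (p - 1) * Y"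
      using H 5 by (simp_all add: h_def)
    show ?thesis
      by (rule FalseE, rule no_solution_top_low_small[OF p X(1) XY h M pU U(1) Up Uq E q_div(2) R(2)])
  next
    case 6
    then have W: "X = 2 ^ (a - b) * Y" "even ((2::int) ^ (a - b))" by (simp_all add: X_def Y_def flip: power_add)
    have "p ^ m = p * U" using 6 m by (simp add: U_def flip: power_Suc)
    then have E1: "q - 1 = (h * p - (p - 1) * X) * U" using H 6 by (simp add: algebra_simps)
    then have "(h * p - (p - 1) * X) * U > 0" using pq p by linarith
    then have c: "h * p - (p - 1) * X > 0" using U by (simp add: zero_less_mult_iff)
    have U23: "U = p\<^sup>2 \<or> p ^ 3 \<le> U"
    proof (cases "m = 3")
      case False
      then show ?thesis using 6 m pow_mono[of 3 u] by (simp add: U_def)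
    qed (use 6 in \<open>simp add: U_def\<close>)
    have E2: "p * (q - p) = (h * p - (p - 1) * X) + (p - 1) * (X + p * Y)"
      using 6 by (simp add: h_def algebra_simps)
    show ?thesis by (rule FalseE, rule no_solution_top_next[OF p c X(1) Y(1) U23 E1 E2 q_div(1) R(1) W])
  next
    case 7
    have "p\<^sup>2 * U = p ^ (2 + u)" by (simp only: U_def power_add)
    also have "\<dots> \<le> p ^ m" using 7 m by (intro pow_mono) simp
    finally have pU: "p\<^sup>2 * U \<le> p ^ m" .
    have M34: "p ^ m = p ^ 3 \<or> p ^ 4 \<le> p ^ m"
    proof (cases "m = 3")
      case False
      then show ?thesis using m by (intro disjI2 pow_mono) simp
    qed simp
    have E: "q - 1 + (p - 1) * X * U = h * p ^ m" "q = p + h + (p - 1) * Y"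
      using H 7 by (simp_all add: h_def)
    show ?thesis
      by (rule FalseE, rule no_solution_top_low_large[OF p X Y(1) h M34 pU U Uq E q_div(2) R(2)])
  qed
qed

section \<open>Divisor sums and divisors of a power of two times an odd prime power\<close>

lemma sigma_mult_coprime:
  assumes "coprime a b"
  shows "sigma (a * b) = sigma a * sigma b"
proof -
  let ?f = "\<lambda>(x, y). x * y :: nat" and ?D = "{d. d dvd a} \<times> {d. d dvd b}"
  have "{d. d dvd a * b} = ?f ` ?D"
  proof (intro equalityI subsetI)
    fix d assume "d \<in> {d. d dvd a * b}"
    then obtain x y where "d = x * y" "x dvd a" "y dvd b" using division_decomp[of d a b] by auto
    then show "d \<in> ?f ` ?D" by (intro image_eqI[of _ _ "(x, y)"]) auto
  qed (auto intro: mult_dvd_mono)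
  moreover have "inj_on ?f ?D"
  proof (rule inj_onI, clarsimp)
    fix x y x' y' assume d: "x dvd a" "y dvd b" "x' dvd a" "y' dvd b" and e: "x * y = x' * y'"
    have "coprime x y'" "coprime x' y" "coprime y x'" "coprime y' x"
      using d assms coprime_divisors coprime_commute by blast+
    moreover have "x dvd x' * y'" "x' dvd x * y" "y dvd x' * y'" "y' dvd x * y"
      using e by (metis dvd_triv_left dvd_triv_right)+
    ultimately have "x dvd x'" "x' dvd x" "y dvd y'" "y' dvd y"
      by (simp_all add: coprime_dvd_mult_left_iff coprime_dvd_mult_right_iff)
    then show "x = x' \<and> y = y'" by (simp add: dvd_antisym)
  qed
  ultimately have "sigma (a * b) = (\<Sum>(x, y)\<in>?D. x * y)"
    by (simp add: sigma_def sum.reindex case_prod_unfold)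
  then show ?thesis by (simp add: sigma_def sum_product sum.cartesian_product)
qed

lemma sigma_prime_power:
  assumes "prime p"
  shows "sigma (p ^ m) = (\<Sum>i\<le>m. p ^ i)"
proof -
  have "{d. d dvd p ^ m} = (\<lambda>i. p ^ i) ` {..m}"
    using assms by (auto simp: divides_primepow_nat)
  moreover have "inj_on (\<lambda>i. p ^ i) {..m}"
    using assms by (auto intro!: inj_onI simp: prime_nat_iff power_inject_exp)
  ultimately show ?thesis by (simp add: sigma_def sum.reindex)
qed

lemma sigma_two_power_mult_prime_power:
  assumes "prime p" "odd p"
  shows "sigma (2 ^ k * p ^ m) = (2 ^ Suc k - 1) * (\<Sum>i\<le>m. p ^ i)"
proof -
  have "coprime (2 ^ k) (p ^ m)" using assms by simp
  moreover have "(\<Sum>i\<le>k. 2 ^ i) = 2 ^ Suc k - (1::nat)"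
    by (induction k) auto
  ultimately show ?thesis
    using assms sigma_prime_power[OF two_is_prime_nat] by (simp add: sigma_mult_coprime sigma_prime_power)
qed

text \<open>Passing to integers allows subtraction. The identity
  \<open>(p - 1) * S = p ^ m - 1\<close> removes the top power \<open>p ^ m\<close> from the divisor
  sum.\<close>

lemma near_perfect_equation_iff:
  fixes p k m d1 d2 :: nat and S :: int
  assumes "prime p" "odd p"
  defines "S \<equiv> (\<Sum>i<m. int p ^ i)"
  shows "sigma (2 ^ k * p ^ m) = 2 * (2 ^ k * p ^ m) + d1 + d2 \<longleftrightarrow>
    (2 ^ Suc k - int p) * S = 1 + int d1 + int d2"
proof -
  have S: "(int p - 1) * S = int p ^ m - 1" by (simp add: S_def power_diff_1_eq)
  have "int (sigma (2 ^ k * p ^ m)) = (2 ^ Suc k - 1) * (S + int p ^ m)"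
    by (simp add: sigma_two_power_mult_prime_power[OF assms(1,2)] S_def of_nat_diff flip: lessThan_Suc_atMost)
  moreover have "int (2 * (2 ^ k * p ^ m) + d1 + d2) = 2 ^ Suc k * int p ^ m + int d1 + int d2" by simp
  moreover have "(2 ^ Suc k - 1) * (S + int p ^ m) - 2 ^ Suc k * int p ^ m = (2 ^ Suc k - int p) * S - 1"
    using S by (simp add: algebra_simps)
  ultimately show ?thesis by (smt (verit) of_nat_eq_iff)
qed

lemma dvd_two_power_mult_prime_power:
  fixes p :: nat
  assumes "prime p" "d dvd 2 ^ k * p ^ m"
  obtains i j where "i \<le> k" "j \<le> m" "d = 2 ^ i * p ^ j"
  using assms by (auto dest!: division_decomp simp: divides_primepow_nat)

lemma two_near_perfect_iff:
  assumes p: "prime p" "odd p" and m: "m \<ge> 3"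
  shows "two_near_perfect (2 ^ k * p ^ m) \<longleftrightarrow> 2 ^ Suc k = p + 1 \<and> m = 3"
proof
  have p3: "p \<ge> 3" using p prime_ge_2_nat[of p] by (cases "p = 2") auto
  assume "two_near_perfect (2 ^ k * p ^ m)"
  then obtain d1 d2 where d: "d1 dvd 2 ^ k * p ^ m" "d2 dvd 2 ^ k * p ^ m" "d1 \<noteq> d2"
    and e: "sigma (2 ^ k * p ^ m) = 2 * (2 ^ k * p ^ m) + d1 + d2"
    by (auto simp: two_near_perfect_def)
  obtain a u where 1: "a \<le> k" "u \<le> m" "d1 = 2 ^ a * p ^ u"
    using dvd_two_power_mult_prime_power[OF p(1) d(1)] .
  obtain b v where 2: "b \<le> k" "v \<le> m" "d2 = 2 ^ b * p ^ v"
    using dvd_two_power_mult_prime_power[OF p(1) d(2)] .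
  have eq: "(2 ^ Suc k - int p) * (\<Sum>i<m. int p ^ i) = 1 + 2 ^ a * int p ^ u + 2 ^ b * int p ^ v"
    using e unfolding near_perfect_equation_iff[OF p] by (simp add: 1 2)
  have "2 ^ Suc k = int p + 1 \<and> m = 3"
  \<comment> \<open>The equation is symmetric in the two divisors, so they may be ordered by the
    exponent of \<open>p\<close>, ties being broken by the power of two.\<close>
  proof (cases "u < v \<or> u = v \<and> a < b")
    case True
    then show ?thesis
      using near_perfect_equation_solution[OF _ _ refl m _ _ _ _ _ refl eq] p p3 1 2 by auto
  next
    case False
    then have "v < u \<or> v = u \<and> b < a" using d(3) 1 2 by (metis linorder_neqE_nat)
    then show ?thesis
      using near_perfect_equation_solution[OF _ _ refl m _ _ _ _ _ refl, where p = "int p" and a = b and b = a and u = v and v = u and k = k]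
        eq p p3 1 2 by (auto simp: add_ac)
  qed
  moreover have "int (2 ^ Suc k) = 2 ^ Suc k" by simp
  ultimately show "2 ^ Suc k = p + 1 \<and> m = 3" by linarith
next
  assume a: "2 ^ Suc k = p + 1 \<and> m = 3"
  \<comment> \<open>The factor in front of \<open>S = 1 + p + p^2\<close> is 1, so the divisors can
    be read off as \<open>p\<close> and \<open>p^2\<close>.\<close>
  have "2 ^ Suc k - int p = 1" using arg_cong[OF conjunct1[OF a], of int] by simp
  then have "sigma (2 ^ k * p ^ m) = 2 * (2 ^ k * p ^ m) + p + p\<^sup>2"
    unfolding near_perfect_equation_iff[OF p] using a by (simp add: eval_nat_numeral)
  moreover have "p dvd 2 ^ k * p ^ m" "p\<^sup>2 dvd 2 ^ k * p ^ m" using m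
    by (auto intro!: dvd_mult le_imp_power_dvd dvd_power)
  moreover have "p \<noteq> p\<^sup>2" "p > 0" using prime_gt_1_nat[OF p(1)] by (auto simp: power2_eq_square)
  ultimately show "two_near_perfect (2 ^ k * p ^ m)" unfolding two_near_perfect_def by auto
qed

section \<open>Mersenne primes and the transfer of infinitude\<close>

lemma mersenne_prime_iff:
  "mersenne_prime p \<longleftrightarrow> prime p \<and> odd p \<and> (\<exists>k\<ge>1. 2 ^ Suc k = p + 1)"
proof
  assume "mersenne_prime p"
  then obtain r where r: "prime p" "r > 0" "p = 2 ^ r - 1" by (auto simp: mersenne_prime_def)
  then have e: "2 ^ r = p + 1" by simp
  \<comment> \<open>The exponent 1 would give the non-prime 1; its exclusion supplies
    \<open>k >= 1\<close>.\<close>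
  then have "r \<noteq> 1" using r(1) by auto
  then obtain k where "r = Suc k" "k \<ge> 1" using r(2) by (cases r) auto
  moreover have "even (p + 1)" unfolding e[symmetric] using r(2) by simp
  ultimately show "prime p \<and> odd p \<and> (\<exists>k\<ge>1. 2 ^ Suc k = p + 1)" using r(1) e by auto
next
  assume "prime p \<and> odd p \<and> (\<exists>k\<ge>1. 2 ^ Suc k = p + 1)"
  then obtain k where "prime p" "2 ^ Suc k = p + 1" by blast
  then have "p = 2 ^ Suc k - 1" by simp
  then show "mersenne_prime p" using \<open>prime p\<close> unfolding mersenne_prime_def by blast
qed

theorem mainTheorem2:
  shows "infinite {n::nat. two_near_perfect n \<and>
           (\<exists>k m p :: nat. k \<ge> 1 \<and> m \<ge> 3 \<and> prime p \<and> odd p \<and> n = 2 ^ k * p ^ m)}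
     \<longleftrightarrow> infinite {q::nat. mersenne_prime q}"
    (is "infinite ?A \<longleftrightarrow> infinite ?B")
proof -
  \<comment> \<open>As \<open>2 ^ Suc k = p + 1\<close>, the factor \<open>2 ^ k\<close> is
    \<open>(p + 1) div 2\<close>, so \<open>n\<close> is a function of \<open>p\<close>
    alone.\<close>
  define f :: "nat \<Rightarrow> nat" where "f p = (p + 1) div 2 * p ^ 3" for p
  have f: "f p = 2 ^ k * p ^ 3" if "2 ^ Suc k = p + 1" for k p
    using that[symmetric] by (simp add: f_def)
  have "?A = f ` ?B"
  proof (intro equalityI subsetI)
    fix n assume "n \<in> ?A"
    then obtain k m p where n: "two_near_perfect n" "k \<ge> 1" "m \<ge> 3" "prime p" "odd p" "n = 2 ^ k * p ^ m"
      by blast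
    then have "2 ^ Suc k = p + 1" "m = 3" using two_near_perfect_iff by blast+
    then have "n = f p" "mersenne_prime p" using n f by (auto simp: mersenne_prime_iff)
    then show "n \<in> f ` ?B" by blast
  next
    fix n assume "n \<in> f ` ?B"
    then obtain p k where p: "n = f p" "prime p" "odd p" "k \<ge> 1" "2 ^ Suc k = p + 1"
      by (auto simp: mersenne_prime_iff)
    then have "n = 2 ^ k * p ^ 3" "two_near_perfect (2 ^ k * p ^ 3)"
      using f two_near_perfect_iff[of p 3 k] by auto
    then show "n \<in> ?A" using p by blast
  qed
  moreover have "strict_mono f"
  proof (rule strict_monoI)
    fix x y :: nat assume "x < y"
    then have "f x \<le> (y + 1) div 2 * x ^ 3" unfolding f_def by (intro mult_right_mono div_le_mono) auto
    also have "\<dots> < (y + 1) div 2 * y ^ 3"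
      using \<open>x < y\<close> by (intro mult_strict_left_mono power_strict_mono) auto
    finally show "f x < f y" by (simp add: f_def)
  qed
  then have "inj_on f ?B" by (metis strict_mono_imp_inj_on inj_on_subset subset_UNIV)
  ultimately show ?thesis by (simp add: finite_image_iff)
qed

end
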